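(* Let $H_n$ and $b_n$ be rational functions in $n$ such that $H_n>0$ for all integers $n\geq -1$ and $b_n>0$ for all integers $n\geq 1$. Assume further that $b_n$ has degree greater than $0$ or, if it has degree $0$, that its leading coefficient is greater than $1$. Then the continued fraction $$\mathop{K}_{n=1}^{\infty}\frac{(H_n+b_nH_{n-1})/H_{n-2}}{b_n}$$ (whose $n$-th partial numerator is $(H_n+b_nH_{n-1})/H_{n-2}$ and whose $n$-th partial denominator is $b_n$) converges, and its limit is $H_0/H_{-1}$.
   Context: Rational functions are taken with real coefficients. If $f_n=g_n/h_n$ is a rational function in $n$, with $g_n,h_n$ polynomials in $n$, the degree of $f_n$ is the degree of $g_n$ minus the degree of $h_n$, and the leading coefficient of $f_n$ is the quotient of the leading coefficient of $g_n$ by the leading coefficient of $h_n$. For sequences $\{a_n\}_{n\ge1}$, $\{b_n\}_{n\ge1}$, the continued fraction $\mathop{K}_{n=1}^{\infty} a_n/b_n$ is $$\cfrac{a_1}{b_1+\cfrac{a_2}{b_2+\cfrac{a_3}{b_3+\cdots}}}.$$ Its $N$-th approximant is $A_N/B_N$, where $A_N=b_NA_{N-1}+a_NA_{N-2}$ and $B_N=b_NB_{N-1}+a_NB_{N-2}$ for $N\ge 1$, with $A_{-1}=1$, $A_0=0$, $B_{-1}=0$, $B_0=1$. It converges, with limit $L$, if $\lim_{N\to\infty}A_N/B_N=L$. *)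

theory Defs
  imports "HOL-Analysis.Analysis" "HOL-Computational_Algebra.Computational_Algebra"
    "HOL-Computational_Algebra.Field_as_Ring"
begin

text \<open>
  A rational function is an element of the fraction field of \<^typ>\<open>real poly\<close>. It is evaluated through
  its reduced representation, so removable singularities are removed. At a pole the value is \<open>0\<close>
  (by \<open>x / 0 = 0\<close>); in particular a positive value implies that the point is not a pole.
\<close>

definition ratfun_eval :: "real poly fract \<Rightarrow> real \<Rightarrow> real" where
  "ratfun_eval f x = (case quot_of_fract f of (g, h) \<Rightarrow> poly g x / poly h x)"

definition ratfun_degree :: "real poly fract \<Rightarrow> int" where
  "ratfun_degree f = (case quot_of_fract f of (g, h) \<Rightarrow> int (degree g) - int (degree h))"

definition ratfun_lead_coeff :: "real poly fract \<Rightarrow> real" where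
  "ratfun_lead_coeff f = (case quot_of_fract f of (g, h) \<Rightarrow> lead_coeff g / lead_coeff h)"

text \<open>The three notions can be computed from any, not necessarily reduced, representation.\<close>

lemma quot_of_fract_cross:
  assumes "h \<noteq> (0 :: real poly)"
  shows "fst (quot_of_fract (Fract g h)) * h = g * snd (quot_of_fract (Fract g h))"
  using Fract_quot_of_fract[of "Fract g h"]
    eq_fract(1)[OF snd_quot_of_fract_nonzero[of "Fract g h"] assms] by blast

lemma ratfun_eval_Fract:
  assumes "poly h x \<noteq> 0"
  shows "ratfun_eval (Fract g h) x = poly g x / poly h x"
proof -
  define p q where "p = fst (quot_of_fract (Fract g h))" and "q = snd (quot_of_fract (Fract g h))"
  have h: "h \<noteq> 0"
    using assms by auto
  have eq: "p * h = g * q"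
    using quot_of_fract_cross[OF h, of g] by (simp add: p_def q_def)
  have cop: "coprime p q"
    unfolding p_def q_def by (rule coprime_quot_of_fract)
  have "q dvd p * h"
    by (simp add: eq)
  hence "q dvd h"
    using cop by (simp add: coprime_commute coprime_dvd_mult_right_iff)
  hence "poly q x \<noteq> 0"
    using assms by (auto elim!: dvdE)
  moreover have "poly p x * poly h x = poly g x * poly q x"
    using arg_cong[OF eq, of "\<lambda>r. poly r x"] by simp
  ultimately show ?thesis
    using assms by (simp add: ratfun_eval_def case_prod_beta p_def q_def divide_simps)
qed

lemma ratfun_degree_Fract:
  assumes "g \<noteq> 0" "h \<noteq> 0"
  shows "ratfun_degree (Fract g h) = int (degree g) - int (degree h)"
proof -
  define p q where "p = fst (quot_of_fract (Fract g h))" and "q = snd (quot_of_fract (Fract g h))"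
  have eq: "p * h = g * q"
    using quot_of_fract_cross[OF assms(2), of g] by (simp add: p_def q_def)
  have q: "q \<noteq> 0"
    by (simp add: q_def)
  with eq assms have "p \<noteq> 0"
    by auto
  with q assms have "degree p + degree h = degree g + degree q"
    using arg_cong[OF eq, of degree] by (simp add: degree_mult_eq)
  thus ?thesis
    by (simp add: ratfun_degree_def case_prod_beta p_def q_def)
qed

lemma ratfun_lead_coeff_Fract:
  assumes "h \<noteq> 0"
  shows "ratfun_lead_coeff (Fract g h) = lead_coeff g / lead_coeff h"
proof -
  define p q where "p = fst (quot_of_fract (Fract g h))" and "q = snd (quot_of_fract (Fract g h))"
  have eq: "p * h = g * q"
    using quot_of_fract_cross[OF assms, of g] by (simp add: p_def q_def)
  have q: "lead_coeff q \<noteq> 0"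
    by (simp add: q_def)
  have "lead_coeff p * lead_coeff h = lead_coeff g * lead_coeff q"
    using arg_cong[OF eq, of lead_coeff] by (simp only: lead_coeff_mult)
  with q assms show ?thesis
    by (simp add: ratfun_lead_coeff_def case_prod_beta p_def q_def divide_simps)
qed

text \<open>
  Canonical numerators and denominators of the continued fraction with partial numerators \<open>a n\<close> and
  partial denominators \<open>b n\<close>, \<open>n \<ge> 1\<close> (the values \<open>a 0\<close> and \<open>b 0\<close> are irrelevant). The index is
  shifted by one: \<open>cf_num a b (N + 1)\<close> is \<open>A\<^sub>N\<close> and \<open>cf_den a b (N + 1)\<close> is \<open>B\<^sub>N\<close>, for \<open>N \<ge> -1\<close>.
\<close>

fun cf_num :: "(nat \<Rightarrow> real) \<Rightarrow> (nat \<Rightarrow> real) \<Rightarrow> nat \<Rightarrow> real" where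
  "cf_num a b 0 = 1"
| "cf_num a b (Suc 0) = 0"
| "cf_num a b (Suc (Suc n)) = b (Suc n) * cf_num a b (Suc n) + a (Suc n) * cf_num a b n"

fun cf_den :: "(nat \<Rightarrow> real) \<Rightarrow> (nat \<Rightarrow> real) \<Rightarrow> nat \<Rightarrow> real" where
  "cf_den a b 0 = 0"
| "cf_den a b (Suc 0) = 1"
| "cf_den a b (Suc (Suc n)) = b (Suc n) * cf_den a b (Suc n) + a (Suc n) * cf_den a b n"

definition cf_approximant :: "(nat \<Rightarrow> real) \<Rightarrow> (nat \<Rightarrow> real) \<Rightarrow> nat \<Rightarrow> real" where
  "cf_approximant a b N = cf_num a b (Suc N) / cf_den a b (Suc N)"

text \<open>
  The first conjunct rules out that approximants with vanishing denominator, which are undefined but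
  here have the value \<open>0\<close>, contribute to the limit.
\<close>

definition cf_converges_to :: "(nat \<Rightarrow> real) \<Rightarrow> (nat \<Rightarrow> real) \<Rightarrow> real \<Rightarrow> bool" where
  "cf_converges_to a b L \<longleftrightarrow>
     (\<forall>\<^sub>F N in sequentially. cf_den a b (Suc N) \<noteq> 0) \<and> cf_approximant a b \<longlonglongrightarrow> L"

end

theory Submission
  imports Defs
begin

text \<open>
  Write \<open>a\<^sub>n = (H\<^sub>n + b\<^sub>n H\<^bsub>n-1\<^esub>) / H\<^bsub>n-2\<^esub>\<close>. The partial numerators are chosen so that
  \<open>X\<^sub>n = (-1)\<^sup>n H\<^sub>n\<close> solves the three-term recurrence \<open>X\<^sub>n = b\<^sub>n X\<^bsub>n-1\<^esub> + a\<^sub>n X\<^bsub>n-2\<^esub>\<close> that the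
  canonical numerators \<open>A\<^sub>n\<close> and denominators \<open>B\<^sub>n\<close> satisfy as well. Put \<open>L = H\<^sub>0 / H\<^bsub>-1\<^esub>\<close>. The
  solution \<open>A\<^sub>n - L B\<^sub>n\<close> has the initial values \<open>1\<close> and \<open>-L\<close> and is therefore a multiple of
  \<open>X\<^sub>n\<close>, which gives the explicit error
  \<open>A\<^sub>n / B\<^sub>n - L = (-1)\<^bsup>n+1\<^esup> (H\<^sub>n / B\<^sub>n) / H\<^bsub>-1\<^esub>\<close>
  (lemma \<open>cf_num_minus_limit_den\<close>).

  It remains to see that \<open>u\<^sub>n = B\<^sub>n / H\<^sub>n\<close> tends to infinity. Dropping the nonnegative term
  \<open>a\<^sub>n B\<^bsub>n-2\<^esub>\<close> from the recurrence gives \<open>u\<^sub>n \<ge> c\<^sub>n u\<^bsub>n-1\<^esub>\<close> with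
  \<open>c\<^sub>n = b\<^sub>n H\<^bsub>n-1\<^esub> / H\<^sub>n\<close>, so \<open>u\<^sub>n\<close> grows geometrically once \<open>c\<^sub>n\<close> stays above some \<open>q > 1\<close>
  (lemma \<open>cf_converges_if_eventually_growing\<close>). For rational functions this is so:
  \<open>H\<^bsub>n-1\<^esub> / H\<^sub>n\<close> tends to \<open>1\<close>, and the assumption on degree and leading coefficient keeps
  \<open>b\<^sub>n\<close> eventually above a constant greater than \<open>1\<close>. Both facts come from
  \<open>f(x) \<sim> c x\<^sup>d\<close>, where \<open>d\<close> is the degree and \<open>c\<close> the leading coefficient of \<open>f\<close>.
\<close>

lemma cf_den_pos:
  fixes a b :: "nat \<Rightarrow> real"
  assumes "\<And>n. n \<ge> 1 \<Longrightarrow> a n > 0" "\<And>n. n \<ge> 1 \<Longrightarrow> b n > 0"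
  shows "cf_den a b (Suc n) > 0"
proof (induction n rule: less_induct)
  case (less n)
  show ?case
  proof (cases n)
    case (Suc m)
    have "cf_den a b m \<ge> 0"
      using less[of "m - 1"] Suc by (cases m) (auto simp: less_imp_le)
    moreover have "cf_den a b (Suc m) > 0"
      using less[of m] Suc by simp
    ultimately show ?thesis
      using assms[of "Suc m"] Suc by (simp add: add_pos_nonneg)
  qed simp
qed

text \<open>
  Here and below \<open>h\<close> is \<open>H\<close> with its index shifted by one, so that \<open>h 0\<close> is \<open>H\<^bsub>-1\<^esub>\<close>, in line with the
  shifted indices of the numerators and denominators. Both sides solve the same recurrence with
  the same two initial values.
\<close>

lemma cf_num_minus_limit_den:
  fixes a b h :: "nat \<Rightarrow> real"
  assumes h: "\<And>n. h n \<noteq> 0"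
    and a: "\<And>n. a (Suc n) = (h (Suc (Suc n)) + b (Suc n) * h (Suc n)) / h n"
  shows "cf_num a b n - h 1 / h 0 * cf_den a b n = (-1) ^ n * h n / h 0"
proof (induction n rule: induct_nat_012)
  case (ge2 n)
  have "cf_num a b (Suc (Suc n)) - h 1 / h 0 * cf_den a b (Suc (Suc n)) =
      b (Suc n) * (cf_num a b (Suc n) - h 1 / h 0 * cf_den a b (Suc n)) +
      a (Suc n) * (cf_num a b n - h 1 / h 0 * cf_den a b n)"
    by (simp add: algebra_simps)
  also have "\<dots> = (-1) ^ Suc (Suc n) * h (Suc (Suc n)) / h 0"
    unfolding ge2 a using h[of n] h[of 0] by (simp add: field_simps)
  finally show ?case .
qed (use h[of 0] in simp_all)

text \<open>
  For \<open>u n = cf_den a b (n + 1) / h (n + 1)\<close> and \<open>c n = b n h n / h (n + 1)\<close> the recurrence reads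
  \<open>u n = c n u (n - 1) + (1 + c n) u (n - 2)\<close>. All terms are nonnegative, so \<open>u\<close> eventually
  grows by a factor of at least \<open>q\<close> in each step, while the \<open>n\<close>-th approximant differs from the
  limit by \<open>1 / (h 0 u n)\<close> in absolute value.
\<close>

lemma cf_converges_if_eventually_growing:
  fixes a b h :: "nat \<Rightarrow> real"
  assumes h: "\<And>n. h n > 0" and b: "\<And>n. n \<ge> 1 \<Longrightarrow> b n > 0"
    and a: "\<And>n. a (Suc n) = (h (Suc (Suc n)) + b (Suc n) * h (Suc n)) / h n"
    and q: "q > 1" and growth: "eventually (\<lambda>n. q \<le> b n * h n / h (Suc n)) sequentially"
  shows "cf_converges_to a b (h 1 / h 0)"
proof -
  have a_pos: "a n > 0" if "n \<ge> 1" for n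
    using that h b[of n] a[of "n - 1"] by (cases n) (auto simp: add_pos_pos)
  have B_pos: "cf_den a b (Suc n) > 0" for n
    using cf_den_pos a_pos b by blast
  have B_nonneg: "cf_den a b n \<ge> 0" for n
    using B_pos[of "n - 1"] by (cases n) auto
  define u where "u n = cf_den a b (Suc n) / h (Suc n)" for n
  have u_pos: "u n > 0" for n
    by (simp add: u_def B_pos h)
  obtain m where m: "\<And>n. n \<ge> m \<Longrightarrow> q \<le> b n * h n / h (Suc n)"
    using growth by (auto simp: eventually_sequentially)
  have step: "q * u n \<le> u (Suc n)" if "n \<ge> m" for n
  proof -
    have "q * u n \<le> (b (Suc n) * h (Suc n) / h (Suc (Suc n))) * u n"
      using m[of "Suc n"] that u_pos[of n] by (intro mult_right_mono) auto
    also have "\<dots> = b (Suc n) * cf_den a b (Suc n) / h (Suc (Suc n))"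
      using h[of "Suc n"] by (simp add: u_def)
    also have "\<dots> \<le> u (Suc n)"
      using a_pos[of "Suc n"] B_nonneg[of n] h[of "Suc (Suc n)"]
      by (simp add: u_def divide_right_mono)
    finally show ?thesis .
  qed
  have geometric: "q ^ k * u m \<le> u (k + m)" for k
  proof (induction k)
    case (Suc k)
    have "q * (q ^ k * u m) \<le> q * u (k + m)"
      using Suc q by (intro mult_left_mono) auto
    also have "\<dots> \<le> u (Suc k + m)"
      using step[of "k + m"] by simp
    finally show ?case by (simp add: mult.assoc)
  qed simp
  have "filterlim (\<lambda>k. q ^ k) at_top sequentially"
    using q by (intro filterlim_at_infinity_imp_filterlim_at_top filterlim_realpow_sequentially_gt1) auto
  hence "filterlim (\<lambda>k. q ^ k * u m) at_top sequentially"
    by (rule filterlim_at_top_mult_tendsto_pos[OF tendsto_const u_pos])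
  hence "filterlim (\<lambda>k. u (k + m)) at_top sequentially"
    by (rule filterlim_at_top_mono) (simp add: geometric)
  hence u_top: "filterlim u at_top sequentially"
    by (simp add: filterlim_at_top eventually_sequentially_seg[of "\<lambda>n. Z \<le> u n" m for Z])
  have error: "cf_approximant a b n - h 1 / h 0 = (-1) ^ Suc n / h 0 * inverse (u n)" for n
  proof -
    have "cf_approximant a b n - h 1 / h 0 =
        (cf_num a b (Suc n) - h 1 / h 0 * cf_den a b (Suc n)) / cf_den a b (Suc n)"
      using B_pos[of n] by (simp add: cf_approximant_def diff_divide_distrib)
    also have "\<dots> = (-1) ^ Suc n * h (Suc n) / h 0 / cf_den a b (Suc n)"
      using cf_num_minus_limit_den[of h a b "Suc n", OF less_imp_neq[OF h, symmetric] a] by simp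
    finally show ?thesis
      by (simp add: u_def)
  qed
  have "(\<lambda>n. 1 / h 0 * inverse (u n)) \<longlonglongrightarrow> 0"
    by (intro tendsto_mult_right_zero tendsto_inverse_0_at_top u_top)
  moreover have "norm (cf_approximant a b n - h 1 / h 0) = 1 / h 0 * inverse (u n)" for n
    unfolding error using u_pos[of n] h[of 0] by (simp add: abs_mult power_abs)
  ultimately have "(\<lambda>n. norm (cf_approximant a b n - h 1 / h 0)) \<longlonglongrightarrow> 0"
    by (simp only:)
  hence "(\<lambda>n. cf_approximant a b n - h 1 / h 0) \<longlonglongrightarrow> 0"
    by (rule tendsto_norm_zero_cancel)
  hence "cf_approximant a b \<longlonglongrightarrow> h 1 / h 0"
    by (simp add: LIM_zero_iff)
  moreover have "cf_den a b (Suc n) \<noteq> 0" for n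
    using B_pos[of n] by simp
  ultimately show ?thesis
    by (simp add: cf_converges_to_def)
qed

text \<open>
  The asymptotics \<open>f(x) \<sim> c x\<^sup>d\<close>, stated as a limit of the quotient \<open>f(x) / x\<^sup>d\<close> so that it
  also covers \<open>f = 0\<close>.
\<close>

lemma ratfun_eval_asymptotics:
  "((\<lambda>x. ratfun_eval f x / x powi ratfun_degree f) \<longlongrightarrow> ratfun_lead_coeff f) at_top"
proof -
  obtain p q where pq: "quot_of_fract f = (p, q)"
    by (cases "quot_of_fract f") auto
  have "q \<noteq> 0"
    using snd_quot_of_fract_nonzero[of f] pq by simp
  hence "((\<lambda>x. (poly p x / x ^ degree p) / (poly q x / x ^ degree q)) \<longlongrightarrow> lead_coeff p / lead_coeff q)
      at_top"
    by (intro tendsto_divide tendsto_mono[OF at_top_le_at_infinity poly_divide_tendsto_aux]) auto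
  moreover have "\<forall>\<^sub>F x in at_top. (poly p x / x ^ degree p) / (poly q x / x ^ degree q) =
      ratfun_eval f x / x powi ratfun_degree f"
    using eventually_gt_at_top[of 0]
    by eventually_elim
      (simp add: ratfun_eval_def ratfun_degree_def pq power_int_diff)
  ultimately have "((\<lambda>x. ratfun_eval f x / x powi ratfun_degree f) \<longlongrightarrow>
      lead_coeff p / lead_coeff q) at_top"
    by (rule Lim_transform_eventually)
  thus ?thesis
    by (simp add: ratfun_lead_coeff_def pq)
qed

lemma ratfun_lead_coeff_nonzero:
  assumes "f \<noteq> 0"
  shows "ratfun_lead_coeff f \<noteq> 0"
proof -
  have "fst (quot_of_fract f) \<noteq> 0"
    using assms Fract_quot_of_fract[of f] by (auto simp: fract_collapse)
  thus ?thesis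
    by (simp add: ratfun_lead_coeff_def case_prod_beta)
qed

lemma ratfun_eval_0 [simp]: "ratfun_eval 0 x = 0"
  by (simp add: ratfun_eval_def)

lemma ratfun_degree_0 [simp]: "ratfun_degree 0 = 0"
  by (simp add: ratfun_degree_def)

lemma ratfun_eval_shift_ratio:
  assumes "f \<noteq> 0"
  shows "((\<lambda>x. ratfun_eval f (x - 1) / ratfun_eval f x) \<longlongrightarrow> 1) at_top"
proof -
  define d c where "d = ratfun_degree f" and "c = ratfun_lead_coeff f"
  define g where "g x = ratfun_eval f x / x powi d" for x
  have c: "c \<noteq> 0"
    using ratfun_lead_coeff_nonzero[OF assms] by (simp add: c_def)
  have g: "(g \<longlongrightarrow> c) at_top"
    unfolding g_def d_def c_def by (rule ratfun_eval_asymptotics)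
  have shift: "filterlim (\<lambda>x::real. x - 1) at_top at_top"
    using filterlim_tendsto_add_at_top[OF tendsto_const[of "-1::real"] filterlim_ident]
    by (simp add: add.commute)
  have "((\<lambda>x::real. 1 - inverse x) \<longlongrightarrow> 1 - 0) at_top"
    by (intro tendsto_diff tendsto_const tendsto_inverse_0_at_top filterlim_ident)
  hence "((\<lambda>x. g (x - 1) / g x * (1 - inverse x) powi d) \<longlongrightarrow> c / c * 1 powi d) at_top"
    using c by (intro tendsto_mult tendsto_divide tendsto_power_int filterlim_compose[OF g shift] g)
      auto
  moreover have "\<forall>\<^sub>F x in at_top. g (x - 1) / g x * (1 - inverse x) powi d =
      ratfun_eval f (x - 1) / ratfun_eval f x"
    using eventually_gt_at_top[of 1]
  proof eventually_elim
    case (elim x)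
    have "1 - inverse x = (x - 1) / x"
      using elim by (simp add: field_simps)
    thus ?case
      using elim by (simp add: g_def power_int_divide_distrib)
  qed
  ultimately have "((\<lambda>x. ratfun_eval f (x - 1) / ratfun_eval f x) \<longlongrightarrow> c / c * 1 powi d) at_top"
    by (rule Lim_transform_eventually)
  thus ?thesis
    using c by simp
qed

text \<open>
  In positive degree, positivity at the integers forces the leading coefficient to be positive and
  hence \<open>b\<close> to tend to infinity; in degree \<open>0\<close> the leading coefficient is the limit of \<open>b\<close>.
\<close>

lemma ratfun_eval_eventually_gt_1:
  assumes pos: "\<And>n::nat. n \<ge> 1 \<Longrightarrow> ratfun_eval b (real n) > 0"
    and deg: "ratfun_degree b > 0 \<or> (ratfun_degree b = 0 \<and> ratfun_lead_coeff b > 1)"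
  obtains q where "q > 1" "\<forall>\<^sub>F n in sequentially. q < ratfun_eval b (real n)"
proof (cases "ratfun_degree b > 0")
  case True
  define d where "d = nat (ratfun_degree b)"
  have "(\<lambda>n. ratfun_eval b (real n) / real n powi ratfun_degree b) \<longlonglongrightarrow> ratfun_lead_coeff b"
    by (rule filterlim_compose[OF ratfun_eval_asymptotics filterlim_real_sequentially])
  hence lim: "(\<lambda>n. ratfun_eval b (real n) / real n ^ d) \<longlonglongrightarrow> ratfun_lead_coeff b"
    using True by (simp add: d_def power_int_def)
  moreover have "\<forall>\<^sub>F n in sequentially. 0 \<le> ratfun_eval b (real n) / real n ^ d"
    using eventually_ge_at_top[of 1] by eventually_elim (use pos in \<open>simp add: less_imp_le\<close>)
  ultimately have "ratfun_lead_coeff b \<ge> 0"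
    by (intro tendsto_lowerbound) auto
  moreover have "b \<noteq> 0"
    using True by auto
  ultimately have lc: "ratfun_lead_coeff b > 0"
    using ratfun_lead_coeff_nonzero[of b] by linarith
  have "filterlim (\<lambda>n. real n ^ d) at_top sequentially"
    using True by (intro filterlim_pow_at_top filterlim_real_sequentially) (simp add: d_def)
  hence "filterlim (\<lambda>n. ratfun_eval b (real n) / real n ^ d * real n ^ d) at_top sequentially"
    by (rule filterlim_tendsto_pos_mult_at_top[OF lim lc])
  hence "\<forall>\<^sub>F n in sequentially. 2 < ratfun_eval b (real n) / real n ^ d * real n ^ d"
    by (simp add: filterlim_at_top_dense)
  hence "\<forall>\<^sub>F n in sequentially. 2 < ratfun_eval b (real n)"
    using eventually_ge_at_top[of 1] by eventually_elim simp
  thus ?thesis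
    by (intro that[of 2]) auto
next
  case False
  with deg have d: "ratfun_degree b = 0" and lc: "ratfun_lead_coeff b > 1"
    by auto
  have "(\<lambda>n. ratfun_eval b (real n)) \<longlonglongrightarrow> ratfun_lead_coeff b"
    using filterlim_compose[OF ratfun_eval_asymptotics[of b] filterlim_real_sequentially] d by simp
  moreover obtain q where "1 < q" "q < ratfun_lead_coeff b"
    using dense[OF lc] by auto
  ultimately show ?thesis
    using that order_tendstoD(1) by blast
qed

theorem proposition1:
  fixes H b :: "real poly fract"
  assumes "\<And>n::int. n \<ge> -1 \<Longrightarrow> ratfun_eval H (of_int n) > 0"
    and "\<And>n::int. n \<ge> 1 \<Longrightarrow> ratfun_eval b (of_int n) > 0"
    and "ratfun_degree b > 0 \<or> (ratfun_degree b = 0 \<and> ratfun_lead_coeff b > 1)"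
  shows "cf_converges_to
           (\<lambda>n. (ratfun_eval H (real n) + ratfun_eval b (real n) * ratfun_eval H (real n - 1))
                  / ratfun_eval H (real n - 2))
           (\<lambda>n. ratfun_eval b (real n))
           (ratfun_eval H 0 / ratfun_eval H (-1))"
proof -
  define h where "h n = ratfun_eval H (real n - 1)" for n
  have h: "h n > 0" for n
    using assms(1)[of "int n - 1"] by (simp add: h_def)
  have b: "ratfun_eval b (real n) > 0" if "n \<ge> 1" for n
    using assms(2)[of "int n"] that by simp
  have "H \<noteq> 0"
    using assms(1)[of 0] by auto
  hence ratio: "(\<lambda>n. h n / h (Suc n)) \<longlonglongrightarrow> 1"
    using filterlim_compose[OF ratfun_eval_shift_ratio filterlim_real_sequentially]
    by (simp add: h_def)
  obtain q where q: "q > 1" "\<forall>\<^sub>F n in sequentially. q < ratfun_eval b (real n)"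
    using ratfun_eval_eventually_gt_1[OF b assms(3)] by blast
  \<comment> \<open>Part of the margin \<open>q - 1\<close> is given up to absorb the factor \<open>h n / h (Suc n)\<close>.\<close>
  obtain r where r: "1 < r" "r < q"
    using dense[OF q(1)] by auto
  have "\<forall>\<^sub>F n in sequentially. r / q < h n / h (Suc n)"
    using order_tendstoD(1)[OF ratio] r by simp
  with q(2) have "\<forall>\<^sub>F n in sequentially. r \<le> ratfun_eval b (real n) * h n / h (Suc n)"
  proof eventually_elim
    case (elim n)
    have "q * (r / q) \<le> ratfun_eval b (real n) * (h n / h (Suc n))"
      using elim r by (intro mult_mono) auto
    thus ?case
      using q(1) by simp
  qed
  from cf_converges_if_eventually_growing[OF h b _ r(1) this] show ?thesis
    by (simp add: h_def)
qed

end
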